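(* Let $f:[n]^3\to\{0,1\}$ be the Exactly-$n$ function: $f(x,y,z)=1$ if and only if $x+y+z=n$. Fix a base $m$ and let $d=1+\lceil\log_m n\rceil$. Then the three-player number-on-the-forehead protocol for $f$ described in the context is correct: on every input $(x,y,z)\in[n]^3$ it outputs $f(x,y,z)$.
   Context: $[n]=\{1,\dots,n\}$. In the number-on-the-forehead (NOF) model, on input $(x,y,z)$ player 1 sees $y,z$, player 2 sees $x,z$, and player 3 sees $x,y$; the players communicate by writing on a blackboard visible to all. Every number is represented in base $m$ by a vector in $\{0,1,\dots,m-1\}^d$, where the first coordinate is the least significant digit and the representation is padded with zeros to length $d$. Write $x_i,y_i,z_i$ for the digits of $x,y,z$, and let $T=(T_1,\dots,T_d)$ be the base-$m$ representation of $n$. The protocol is as follows. (1) Player 1 computes the vector $C_x=C\in\{0,1,2\}^d$ whose $i$-th entry $C_i$ is the $k\in\{0,1,2\}$ satisfying $T_i+(k-1)m<y_i+z_i+C_{i-1}\le T_i+km$, where addition is over $\mathbb{Z}$ and $C_0=0$. (2) Players 2 and 3 compute corresponding vectors $C_y$ and $C_z$ in the same way, from the two inputs each of them sees (player 2 uses $x_i+z_i$ and player 3 uses $x_i+y_i$ in place of $y_i+z_i$). (3) Player 1 writes $C=C_x$ on the blackboard. (4) Players 2 and 3, in turn, write $1$ if their vector ($C_y$, respectively $C_z$) is equal to $C_x$, and $0$ otherwise. (5) If the last two bits written are both equal to $1$, the protocol continues; otherwise it outputs $0$ and terminates. (6) All players compute (in private) the vector $T'$ with $T'_i=T_i+mC_i-C_{i-1}$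 for $i=1,\dots,d$. (7) Regarding $x,y,z$ as their digit vectors in $\mathbb{Z}^d$, the players run a (correct) NOF protocol that decides whether $x+y+z=T'$ in $\mathbb{Z}^d$, and output its answer.
   Formalization: The base is m ≥ 2, and the case m = 2 with n a power of 2 is excluded, because there the protocol wrongly outputs 1 on the input (n,n,n), although 3n ≠ n. *)

theory Defs
  imports Complex_Main "Jordan_Normal_Form.Matrix"
begin

datatype player = P1 | P2 | P3

fun seen :: "player \<Rightarrow> 'a \<times> 'a \<times> 'a \<Rightarrow> 'a \<times> 'a" where
  "seen P1 (x, y, z) = (y, z)"
| "seen P2 (x, y, z) = (x, z)"
| "seen P3 (x, y, z) = (x, y)"

text \<open>A deterministic number-on-the-forehead protocol is a well-founded tree. At a node
  \<open>Write p f K\<close> player \<open>p\<close> writes the word \<open>f s\<close> on the blackboard, where \<open>s\<close> is the pair of inputs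
  that \<open>p\<close> sees, and the protocol goes on with \<open>K (f s)\<close>. So every message depends only on the
  two visible inputs and the blackboard, and the output only on the blackboard.\<close>

datatype ('a, 'o) nof =
    Output 'o
  | Write player "'a \<times> 'a \<Rightarrow> int list" "int list \<Rightarrow> ('a, 'o) nof"

primrec run :: "('a, 'o) nof \<Rightarrow> 'a \<times> 'a \<times> 'a \<Rightarrow> 'o" where
  "run (Output b) = (\<lambda>inp. b)"
| "run (Write p f K) = (\<lambda>inp. run (K (f (seen p inp))) inp)"

definition nof_computes :: "'a set \<Rightarrow> ('a, 'o) nof \<Rightarrow> ('a \<times> 'a \<times> 'a \<Rightarrow> 'o) \<Rightarrow> bool" where
  "nof_computes X P f \<longleftrightarrow> (\<forall>x\<in>X. \<forall>y\<in>X. \<forall>z\<in>X. run P (x, y, z) = f (x, y, z))"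

text \<open>Run a protocol after applying \<open>g\<close> to each of the three inputs separately; nobody needs to
  see more than before for that.\<close>

primrec recode_inputs :: "('a \<Rightarrow> 'b) \<Rightarrow> ('b, 'o) nof \<Rightarrow> ('a, 'o) nof" where
  "recode_inputs g (Output b) = Output b"
| "recode_inputs g (Write p f K) =
     Write p (\<lambda>s. f (map_prod g g s)) (\<lambda>w. recode_inputs g (K w))"

definition exactly_n :: "nat \<Rightarrow> nat \<times> nat \<times> nat \<Rightarrow> nat" where
  "exactly_n n = (\<lambda>(x, y, z). if x + y + z = n then 1 else 0)"

definition num_digits :: "nat \<Rightarrow> nat \<Rightarrow> nat" where
  "num_digits m n = nat (1 + \<lceil>log (real m) (real n)\<rceil>)"

text \<open>Vectors are indexed from 0, so entry \<open>i\<close> is the coefficient of \<open>m ^ i\<close>.\<close>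

definition digits :: "nat \<Rightarrow> nat \<Rightarrow> nat \<Rightarrow> int vec" where
  "digits m d x = vec d (\<lambda>i. int (x div m ^ i mod m))"

definition digit_vecs :: "nat \<Rightarrow> nat \<Rightarrow> int vec set" where
  "digit_vecs m d = {v \<in> carrier_vec d. \<forall>i<d. v $ i \<in> {0..<int m}}"

text \<open>\<open>carry m T u v i\<close> is the carry out of the \<open>i\<close> lowest positions, i.e. $C_i$ with $C_0 = 0$;
  it therefore refers to the vector entries with index \<open>i - 1\<close>.\<close>

primrec carry :: "nat \<Rightarrow> int vec \<Rightarrow> int vec \<Rightarrow> int vec \<Rightarrow> nat \<Rightarrow> int" where
  "carry m T u v 0 = 0"
| "carry m T u v (Suc i) =
     (THE k. k \<in> {0, 1, 2} \<and>
        T $ i + (k - 1) * int m < u $ i + v $ i + carry m T u v i \<and>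
        u $ i + v $ i + carry m T u v i \<le> T $ i + k * int m)"

definition carry_vec :: "nat \<Rightarrow> nat \<Rightarrow> int vec \<Rightarrow> int vec \<Rightarrow> int vec \<Rightarrow> int vec" where
  "carry_vec m d T u v = vec d (\<lambda>i. carry m T u v (Suc i))"

definition shifted_target :: "nat \<Rightarrow> nat \<Rightarrow> int vec \<Rightarrow> int vec \<Rightarrow> int vec" where
  "shifted_target m d T C =
     vec d (\<lambda>i. T $ i + int m * C $ i - (if i = 0 then 0 else C $ (i - 1)))"

text \<open>\<open>sub T'\<close> is the protocol that is run at the end to decide $x + y + z = T'$.\<close>

definition exactly_n_protocol ::
    "nat \<Rightarrow> nat \<Rightarrow> (int vec \<Rightarrow> (int vec, nat) nof) \<Rightarrow> (nat, nat) nof" where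
  "exactly_n_protocol m n sub =
    (let d = num_digits m n;
         T = digits m d n;
         carries = (\<lambda>(a, b). carry_vec m d T (digits m d a) (digits m d b))
     in Write P1 (\<lambda>s. list_of_vec (carries s)) (\<lambda>w. let C = vec_of_list w in
        Write P2 (\<lambda>s. if carries s = C then [1] else [0]) (\<lambda>b2.
        Write P3 (\<lambda>s. if carries s = C then [1] else [0]) (\<lambda>b3.
          if b2 = [1] \<and> b3 = [1]
          then recode_inputs (digits m d) (sub (shifted_target m d T C))
          else Output 0))))"

definition vector_sum_test :: "int vec \<Rightarrow> int vec \<times> int vec \<times> int vec \<Rightarrow> nat" where
  "vector_sum_test t = (\<lambda>(x, y, z). if x + y + z = t then 1 else 0)"

lemma run_recode_inputs: "run (recode_inputs g P) (x,y,z) = run P (g x, g y, g z)"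
proof (induction P)
  case (Write p f K) show ?case by (cases p) (simp_all add: Write)
qed simp

lemma run_exactly_n_protocol: "run (exactly_n_protocol m n sub) (x,y,z) =
 (let d = num_digits m n; T = digits m d n; D = digits m d; C = carry_vec m d T (D y) (D z) in
  if carry_vec m d T (D x) (D z) = C \<and> carry_vec m d T (D x) (D y) = C
  then run (sub (shifted_target m d T C)) (D x, D y, D z) else 0)"
  by (auto simp: exactly_n_protocol_def Let_def vec_list run_recode_inputs)

text \<open>If the protocol accepts, then $x + y + z = n + C_d m^d$ for the final carry $C_d$. As
  $m^d \ge mn$ and $x + y + z \le 3n$, this forces $C_d = 0$, except when $m = 2$ and $n$ is a power
  of 2: then $2n = m^d$, and the input $(n, n, n)$ is wrongly accepted with $C_d = 1$.\<close>

lemma carry_pow2: fixes k :: nat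
  defines "T \<equiv> digits 2 (Suc k) (2 ^ k)"
  shows "i \<le> k \<Longrightarrow> carry 2 T T T i = 0" "carry 2 T T T (Suc k) = 1"
proof -
  have dig: "T $ i = (if i = k then 1 else 0)" if "i \<le> k" for i
    using that by (auto simp: T_def digits_def power_diff[symmetric])
  show *: "carry 2 T T T i = 0" if "i \<le> k" for i
    using that by (induction i) (auto simp: dig)
  show "carry 2 T T T (Suc k) = 1"
    by (auto simp: dig * intro!: the_equality)
qed

lemma exactly_n_protocol_wrong_for_base_2_powers:
  assumes "\<And>t. t \<in> carrier_vec (Suc k) \<Longrightarrow>
      nof_computes (digit_vecs 2 (Suc k)) (sub t) (vector_sum_test t)"
  shows "run (exactly_n_protocol 2 (2 ^ k) sub) (2 ^ k, 2 ^ k, 2 ^ k) = 1"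
    and "exactly_n (2 ^ k) (2 ^ k, 2 ^ k, 2 ^ k) = 0"
proof -
  have nd: "num_digits 2 (2^k) = Suc k" by (simp add: num_digits_def log_nat_power)
  define T where "T = digits 2 (Suc k) (2 ^ k)"
  have dig: "T $ i = (if i = k then 1 else 0)" if "i \<le> k" for i
    using that by (auto simp: T_def digits_def power_diff[symmetric])
  have Tc: "T \<in> carrier_vec (Suc k)" by (simp add: T_def digits_def)
  define S where "S = shifted_target 2 (Suc k) T (carry_vec 2 (Suc k) T T T)"
  note c = carry_pow2[where k=k, folded T_def]
  have cv: "carry_vec 2 (Suc k) T T T $ i = (if i = k then 1 else 0)" if "i \<le> k" for i
    using that c(1)[of "Suc i"] c(2) by (auto simp: carry_vec_def simp del: carry.simps)
  have eq: "T + T + T = S"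
  proof (rule eq_vecI)
    show "dim_vec (T + T + T) = dim_vec S" using Tc by (simp add: S_def shifted_target_def)
    fix i assume "i < dim_vec S"
    then have "i \<le> k" by (simp add: S_def shifted_target_def)
    then show "(T + T + T) $ i = S $ i" using Tc by (cases i) (auto simp: S_def shifted_target_def dig cv)
  qed
  have "T \<in> digit_vecs 2 (Suc k)" by (auto simp: T_def digits_def digit_vecs_def)
  then have "run (sub S) (T, T, T) = 1"
    using assms[of S] eq by (simp add: nof_computes_def vector_sum_test_def S_def shifted_target_def)
  then show "run (exactly_n_protocol 2 (2 ^ k) sub) (2 ^ k, 2 ^ k, 2 ^ k) = 1"
    by (simp add: run_exactly_n_protocol Let_def nd T_def S_def)
  show "exactly_n (2 ^ k) (2 ^ k, 2 ^ k, 2 ^ k) = 0" by (simp add: exactly_n_def)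
qed

end

theory Submission
  imports Defs
begin

text \<open>If \<open>x + y + z = n\<close>, the carries \<open>c\<close> of the three-summand addition satisfy
  \<open>y\<^sub>i + z\<^sub>i + c\<^sub>i = T\<^sub>i + m c\<^sub>i\<^sub>+\<^sub>1 - x\<^sub>i\<close> with \<open>0 \<le> x\<^sub>i < m\<close>, which is exactly the condition by which
  player 1 picks the next carry; by symmetry all three players find \<open>c\<close>, and \<open>x + y + z = T'\<close>
  digit by digit. Conversely, the weighted digit sum of \<open>T'\<close> telescopes to \<open>n + C\<^sub>d m\<^sup>d\<close>, so
  acceptance means \<open>x + y + z = n + C\<^sub>d m\<^sup>d\<close>. As \<open>x + y + z \<le> 3n\<close> and \<open>m n \<le> m\<^sup>d\<close>, a nonzero
  \<open>C\<^sub>d\<close> would force \<open>m = 2\<close> and \<open>n = 2\<^sup>d\<^sup>-\<^sup>1\<close>.\<close>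

section \<open>Base-\<open>m\<close> digits and residues modulo powers of \<open>m\<close>\<close>

lemma mod_power_Suc: "x mod m ^ Suc i = x mod m ^ i + m ^ i * (x div m ^ i mod m)"
  for x m :: nat
  using mod_mult2_eq[of x "m ^ i" m] by (simp add: mult.commute)

lemma digits_index: "i < d \<Longrightarrow> digits m d x $ i = int (x div m ^ i mod m)"
  by (simp add: digits_def)

lemma dim_digits [simp]: "dim_vec (digits m d x) = d"
  by (simp add: digits_def)

lemma digits_in_digit_vecs: "m > 0 \<Longrightarrow> digits m d x \<in> digit_vecs m d"
  by (auto simp: digits_def digit_vecs_def)

lemma digits_bounds: "m > 0 \<Longrightarrow> i < d \<Longrightarrow> 0 \<le> digits m d x $ i \<and> digits m d x $ i < int m"
  by (simp add: digits_index)

lemma sum_digits: "j \<le> d \<Longrightarrow> (\<Sum>i<j. digits m d x $ i * int m ^ i) = int (x mod m ^ j)"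
proof (induction j)
  case (Suc j)
  then show ?case
    by (simp add: digits_index mod_power_Suc del: power_Suc)
qed simp

section \<open>Carries chosen by the players\<close>

text \<open>Chaining the lower bound for one candidate with the upper bound for another gives
  \<open>k' - 1 < k\<close> and \<open>k - 1 < k'\<close>, so the description in
  \<open>carry\<close> has at most one solution.\<close>

lemma carry_SucI:
  assumes "k \<in> {0, 1, 2}"
    and "T $ i + (k - 1) * int m < u $ i + v $ i + carry m T u v i"
    and "u $ i + v $ i + carry m T u v i \<le> T $ i + k * int m"
  shows "carry m T u v (Suc i) = k"
proof -
  have "k' = k" if "T $ i + (k' - 1) * int m < u $ i + v $ i + carry m T u v i"
    and "u $ i + v $ i + carry m T u v i \<le> T $ i + k' * int m" for k'
  proof -
    have "(k' - 1) * int m < k * int m" "(k - 1) * int m < k' * int m"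
      using that assms by linarith+
    then show ?thesis
      by (simp add: mult_less_cancel_right)
  qed
  with assms show ?thesis
    unfolding carry.simps by (intro the_equality) blast+
qed

text \<open>The description in \<open>carry\<close> needs a solution to say anything. The three
  intervals together cover everything above \<open>T $ i - m\<close> up to
  \<open>T $ i + 2 * m\<close>; since \<open>0 \<le> T $ i < m\<close>, this contains all sums from
  \<open>0\<close> to \<open>2 * (m - 1) + 2\<close>.\<close>

lemma carry_range:
  assumes "T \<in> digit_vecs m d" "u \<in> digit_vecs m d" "v \<in> digit_vecs m d"
  shows "i \<le> d \<Longrightarrow> carry m T u v i \<in> {0, 1, 2}"
proof (induction i)
  case (Suc i)
  define s where "s = u $ i + v $ i + carry m T u v i"
  have entry: "0 \<le> w $ i \<and> w $ i < int m" if "w \<in> digit_vecs m d" for w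
    using that Suc.prems by (auto simp: digit_vecs_def)
  have "carry m T u v i \<in> {0, 1, 2}"
    using Suc by simp
  then have "0 \<le> T $ i" "T $ i < int m" "0 \<le> s" "s \<le> 2 * int m"
    using assms[THEN entry] by (auto simp: s_def)
  then have "\<exists>k\<in>{0, 1, 2}. T $ i + (k - 1) * int m < s \<and> s \<le> T $ i + k * int m"
    by auto
  then obtain k where k: "k \<in> {0, 1, 2}"
    "T $ i + (k - 1) * int m < s" "s \<le> T $ i + k * int m"
    by blast
  then have "carry m T u v (Suc i) = k"
    unfolding s_def by (rule carry_SucI)
  with k show ?case by simp
qed simp

lemma shifted_target_index:
  "i < d \<Longrightarrow> shifted_target m d T (carry_vec m d T u v) $ i =
     T $ i + int m * carry m T u v (Suc i) - carry m T u v i"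
  \<comment> \<open>For \<open>i = 0\<close> nothing is subtracted, in accordance with
    \<open>carry m T u v 0 = 0\<close>; otherwise entry \<open>i - 1\<close> of
    \<open>carry_vec\<close> is the carry into position \<open>i\<close>.\<close>
  by (cases i) (simp_all add: shifted_target_def carry_vec_def del: carry.simps(2))

lemma sum_shifted_target:
  "j \<le> d \<Longrightarrow> (\<Sum>i<j. shifted_target m d T (carry_vec m d T u v) $ i * int m ^ i) =
     (\<Sum>i<j. T $ i * int m ^ i) + carry m T u v j * int m ^ j"
proof (induction j)
  case (Suc j)
  then show ?case
    by (simp add: shifted_target_index algebra_simps del: carry.simps(2))
qed simp

section \<open>Carries of the three-summand addition\<close>

text \<open>The true carry into position \<open>i\<close>, in closed form instead of by recursion:
  symmetry in the summands and the bound 2 can then be read off.\<close>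

definition sum_carry :: "nat \<Rightarrow> nat \<Rightarrow> nat \<Rightarrow> nat \<Rightarrow> nat \<Rightarrow> nat" where
  "sum_carry m x y z i = (x mod m ^ i + y mod m ^ i + z mod m ^ i) div m ^ i"

lemma sum_carry_0 [simp]: "sum_carry m x y z 0 = 0"
  by (simp add: sum_carry_def)

lemma sum_carry_le: "m > 0 \<Longrightarrow> sum_carry m x y z i \<le> 2"
proof -
  assume "m > 0"
  then have "x mod m ^ i < m ^ i" "y mod m ^ i < m ^ i" "z mod m ^ i < m ^ i"
    by simp_all
  then have "x mod m ^ i + y mod m ^ i + z mod m ^ i < 3 * m ^ i"
    by linarith
  then have "sum_carry m x y z i < 3"
    unfolding sum_carry_def by (rule less_mult_imp_div_less)
  then show ?thesis by simp
qed

text \<open>Divide the sum of the residues with remainder, once by \<open>m ^ i\<close> and once by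
  \<open>m ^ Suc i\<close>; the difference of the two equations is the claim times
  \<open>m ^ i\<close>.\<close>

lemma sum_carry_Suc:
  assumes "m > 0"
  shows "x div m ^ i mod m + y div m ^ i mod m + z div m ^ i mod m + sum_carry m x y z i =
     (x + y + z) div m ^ i mod m + m * sum_carry m x y z (Suc i)"
proof -
  have S: "x mod m ^ j + y mod m ^ j + z mod m ^ j =
      m ^ j * sum_carry m x y z j + (x + y + z) mod m ^ j" for j
  proof -
    have "(x + y + z) mod m ^ j = (x mod m ^ j + y mod m ^ j + z mod m ^ j) mod m ^ j"
      by (metis mod_add_eq mod_add_left_eq)
    then show ?thesis
      unfolding sum_carry_def by simp
  qed
  have "m ^ i * (x div m ^ i mod m + y div m ^ i mod m + z div m ^ i mod m + sum_carry m x y z i) =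
     m ^ i * ((x + y + z) div m ^ i mod m + m * sum_carry m x y z (Suc i))"
    using S[of i] S[of "Suc i"] unfolding mod_power_Suc by (simp add: algebra_simps)
  then show ?thesis
    using assms by simp
qed

lemma sum_carry_digits:
  assumes "m > 0" "i < d"
  shows "digits m d x $ i + digits m d y $ i + digits m d z $ i + int (sum_carry m x y z i) =
     digits m d (x + y + z) $ i + int m * int (sum_carry m x y z (Suc i))"
  using sum_carry_Suc[OF assms(1), of x i y z] assms(2)
  by (simp add: digits_index flip: of_nat_add of_nat_mult)

lemma carry_eq_sum_carry:
  assumes "m > 0"
  shows "i \<le> d \<Longrightarrow>
    carry m (digits m d (x + y + z)) (digits m d y) (digits m d z) i = int (sum_carry m x y z i)"
proof (induction i)
  case (Suc i)
  show ?case
  proof (rule carry_SucI)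
    show "int (sum_carry m x y z (Suc i)) \<in> {0, 1, 2}"
      using sum_carry_le[OF assms, of x y z "Suc i"] by auto
  qed (use Suc sum_carry_digits[OF assms, of i d x y z] digits_bounds[OF assms, of i d x]
      in \<open>simp_all add: algebra_simps\<close>)
qed simp

lemma sum_carry_commute:
  "sum_carry m y x z = sum_carry m x y z" "sum_carry m z x y = sum_carry m x y z"
  by (simp_all add: sum_carry_def fun_eq_iff add_ac)

lemma carry_vec_eq_sum_carry:
  assumes "m > 0" and "x + y + z = n"
  shows "carry_vec m d (digits m d n) (digits m d y) (digits m d z) =
      vec d (\<lambda>i. int (sum_carry m x y z (Suc i)))"
    and "carry_vec m d (digits m d n) (digits m d x) (digits m d z) =
      vec d (\<lambda>i. int (sum_carry m x y z (Suc i)))"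
    and "carry_vec m d (digits m d n) (digits m d x) (digits m d y) =
      vec d (\<lambda>i. int (sum_carry m x y z (Suc i)))"
proof -
  \<comment> \<open>In each ordering the number on the player's own forehead comes first, as
    \<open>carry_eq_sum_carry\<close> expects.\<close>
  have n: "n = x + y + z" "n = y + x + z" "n = z + x + y"
    using assms(2) by simp_all
  note c = carry_eq_sum_carry[OF assms(1), where d = d]
  show "carry_vec m d (digits m d n) (digits m d y) (digits m d z) =
      vec d (\<lambda>i. int (sum_carry m x y z (Suc i)))"
    unfolding n(1) by (intro eq_vecI) (simp_all add: carry_vec_def c del: carry.simps(2))
  show "carry_vec m d (digits m d n) (digits m d x) (digits m d z) =
      vec d (\<lambda>i. int (sum_carry m x y z (Suc i)))"
    unfolding n(2) by (intro eq_vecI)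
      (simp_all add: carry_vec_def c sum_carry_commute(1)[of m y x z] del: carry.simps(2))
  show "carry_vec m d (digits m d n) (digits m d x) (digits m d y) =
      vec d (\<lambda>i. int (sum_carry m x y z (Suc i)))"
    unfolding n(3) by (intro eq_vecI)
      (simp_all add: carry_vec_def c sum_carry_commute(2)[of m z x y] del: carry.simps(2))
qed

lemma digits_sum_eq_shifted_target:
  assumes "m > 0" and "x + y + z = n"
  shows "digits m d x + digits m d y + digits m d z = shifted_target m d (digits m d n)
    (carry_vec m d (digits m d n) (digits m d y) (digits m d z))" (is "_ = ?T'")
proof (rule eq_vecI)
  fix i assume "i < dim_vec ?T'"
  then have i: "i < d" by (simp add: shifted_target_def)
  then show "(digits m d x + digits m d y + digits m d z) $ i = ?T' $ i"
    using sum_carry_digits[OF assms(1) i, of x y z]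
    by (simp add: shifted_target_index carry_eq_sum_carry[OF assms(1)] flip: assms(2)
        del: carry.simps(2))
qed (simp add: shifted_target_def)

section \<open>Vanishing of the final carry\<close>

text \<open>The digit beyond the rounded logarithm turns \<open>n \<le> m ^ k\<close> into
  \<open>m * n \<le> m ^ Suc k\<close>, which limits the final carry.\<close>

lemma num_digits_eq_Suc:
  assumes "m \<ge> 2" "n \<ge> 1"
  obtains k where "num_digits m n = Suc k" "n \<le> m ^ k"
proof
  define k where "k = nat \<lceil>log (real m) (real n)\<rceil>"
  have log: "log (real m) (real n) \<ge> 0"
    using assms by simp
  then have c: "\<lceil>log (real m) (real n)\<rceil> \<ge> 0"
    by simp
  then show "num_digits m n = Suc k"
    by (simp add: num_digits_def k_def nat_add_distrib)
  have "log (real m) (real n) \<le> real k"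
    unfolding k_def using c by linarith
  then have "real n \<le> real m powr real k"
    using assms by (simp add: log_le_iff)
  also have "\<dots> = real (m ^ k)"
    using assms by (simp add: powr_realpow)
  finally show "n \<le> m ^ k"
    by linarith
qed

lemma sum_eq_if_digits_sum_eq_shifted_target:
  fixes m n x y z :: nat
  defines "d \<equiv> num_digits m n"
  defines "T \<equiv> digits m d n"
  assumes base: "m \<ge> 2" and nd: "\<not> (m = 2 \<and> (\<exists>j. n = 2 ^ j))"
    and in_range: "x \<in> {1..n}" "y \<in> {1..n}" "z \<in> {1..n}"
    and eq: "digits m d x + digits m d y + digits m d z =
      shifted_target m d T (carry_vec m d T (digits m d y) (digits m d z))"
      (is "_ = ?T'")
  shows "x + y + z = n"
proof -
  have "n \<ge> 1"
    using in_range(1) by simp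
  with base obtain k where k: "d = Suc k" "n \<le> m ^ k"
    unfolding d_def by (rule num_digits_eq_Suc)
  \<comment> \<open>Strictness matters because \<open>n = m ^ k\<close> is possible;
    \<open>n < m ^ d\<close> ensures that no input loses digits.\<close>
  have "1 * m ^ k < m * m ^ k"
    using base by (intro mult_strict_right_mono) auto
  then have "n < m ^ d"
    using k(2) unfolding k(1) power_Suc by linarith
  then have mods: "n mod m ^ d = n" "x mod m ^ d = x" "y mod m ^ d = y" "z mod m ^ d = z"
    using in_range by simp_all
  define C where "C = carry m T (digits m d y) (digits m d z) d"
  have C: "C \<in> {0, 1, 2}"
    unfolding C_def T_def using base by (intro carry_range[where d = d] digits_in_digit_vecs) auto
  have "int (x + y + z) =
      (\<Sum>i<d. digits m d x $ i * int m ^ i) + (\<Sum>i<d. digits m d y $ i * int m ^ i) +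
      (\<Sum>i<d. digits m d z $ i * int m ^ i)"
    by (simp add: sum_digits mods)
  also have "\<dots> = (\<Sum>i<d. (digits m d x + digits m d y + digits m d z) $ i * int m ^ i)"
    by (simp add: algebra_simps flip: sum.distrib)
  also have "\<dots> = int n + C * int m ^ d"
    unfolding eq by (simp add: sum_shifted_target T_def sum_digits mods C_def)
  finally have total: "int (x + y + z) = int n + C * int m ^ d" .
  have "C = 0"
  proof (rule ccontr)
    assume "C \<noteq> 0"
    then have "1 * int m ^ d \<le> C * int m ^ d"
      using C by (intro mult_right_mono) auto
    \<comment> \<open>Here \<open>n + m ^ d \<le> x + y + z \<le> 3 * n\<close>.\<close>
    then have "int (m ^ d) \<le> int (2 * n)"
      using total in_range by simp
    then have le: "m * m ^ k \<le> 2 * n"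
      by (simp only: of_nat_le_iff k(1) power_Suc)
    also have "\<dots> \<le> 2 * m ^ k"
      using k by simp
    finally have "m = 2"
      using base by simp
    \<comment> \<open>Both estimates are now tight:
      \<open>2 * 2 ^ k \<le> 2 * n \<le> 2 * 2 ^ k\<close>.\<close>
    with le k have "n = 2 ^ k" by simp
    with \<open>m = 2\<close> nd show False by blast
  qed
  with total show ?thesis by simp
qed

theorem lemma22:
  fixes m n :: nat and sub :: "int vec \<Rightarrow> (int vec, nat) nof"
  assumes base: "m \<ge> 2"
    and not_degenerate: "\<not> (m = 2 \<and> (\<exists>j. n = 2 ^ j))"
    and sub_correct: "\<And>t. t \<in> carrier_vec (num_digits m n) \<Longrightarrow>
      nof_computes (digit_vecs m (num_digits m n)) (sub t) (vector_sum_test t)"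
  shows "nof_computes {1..n} (exactly_n_protocol m n sub) (exactly_n n)"
  unfolding nof_computes_def
proof (intro ballI)
  fix x y z assume in_range: "x \<in> {1..n}" "y \<in> {1..n}" "z \<in> {1..n}"
  define d where "d = num_digits m n"
  define T where "T = digits m d n"
  define D where "D = digits m d"
  define C where "C = carry_vec m d T (D y) (D z)"
  define T' where "T' = shifted_target m d T C"
  have m: "m > 0" using base by simp
  have "T' \<in> carrier_vec d"
    by (simp add: T'_def shifted_target_def)
  then have sub: "run (sub T') (D x, D y, D z) = (if D x + D y + D z = T' then 1 else 0)"
    using sub_correct[of T'] digits_in_digit_vecs[OF m, of d]
    by (simp add: d_def D_def nof_computes_def vector_sum_test_def)
  have run: "run (exactly_n_protocol m n sub) (x, y, z) =
      (if carry_vec m d T (D x) (D z) = C \<and> carry_vec m d T (D x) (D y) = C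
       then run (sub T') (D x, D y, D z) else 0)"
    by (simp add: run_exactly_n_protocol Let_def d_def T_def D_def C_def T'_def)
  show "run (exactly_n_protocol m n sub) (x, y, z) = exactly_n n (x, y, z)"
  proof (cases "x + y + z = n")
    case True
    then have "carry_vec m d T (D x) (D z) = C" "carry_vec m d T (D x) (D y) = C"
      by (simp_all add: C_def T_def D_def carry_vec_eq_sum_carry[OF m True])
    moreover have "D x + D y + D z = T'"
      unfolding T'_def C_def T_def D_def by (rule digits_sum_eq_shifted_target[OF m True])
    ultimately show ?thesis
      by (simp add: run sub exactly_n_def True)
  next
    case False
    \<comment> \<open>The final test alone rejects, so the output is 0 whichever bits players 2 and
      3 wrote.\<close>
    then have "D x + D y + D z \<noteq> T'"
      using sum_eq_if_digits_sum_eq_shifted_target[OF base not_degenerate in_range]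
      unfolding T'_def C_def T_def D_def d_def by blast
    with False show ?thesis
      by (simp add: run sub exactly_n_def)
  qed
qed

end
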